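(* Let $f:\mathbb{R}^n\to\mathbb{R}$ be continuously differentiable, with gradient $g=\nabla f$ Lipschitz continuous with constant $L\ge 0$ (that is, $\|g(x)-g(y)\|\le L\|x-y\|$ for all $x,y\in\mathbb{R}^n$), and suppose there is a constant $f_{\rm low}$ with $f(x)\ge f_{\rm low}$ for all $x\in\mathbb{R}^n$. Let $\varsigma\in(0,1]$, $\vartheta\in(0,1]$, $\theta>0$ and $\mu\in(0,1)$, and let $\{x_k\}_{k\ge0}$ be generated by the ASTR1 algorithm (with constants $\kappa_B\ge1$, $\tau\in(0,1]$) applied to $f$, with scaling factors satisfying, for all $i\in\{1,\dots,n\}$ and all $k\ge 0$, $$w_{i,k}\in\left[\sqrt{\vartheta}\,v_{i,k},\,v_{i,k}\right]\quad\text{where}\quad v_{i,k}=\theta\Big(\varsigma+\sum_{\ell=0}^k g_{i,\ell}^2\Big)^{\mu}.$$ Let $\Gamma_0=f(x_0)-f_{\rm low}$ and $\kappa_{BBL}=\kappa_B(\kappa_B+L)$. Then, for all $k\ge0$: (i) if $0<\mu<\frac12$, $$\frac{1}{k+1}\sum_{j=0}^k\|g_j\|^2\le\frac{\kappa_1}{k+1},\qquad \kappa_1=\max\left\{\varsigma,\ \left[\frac{2^{2\mu}\vartheta(1-2\mu)\theta^2\Gamma_0}{n(\kappa_B+L)}\right]^{\frac{1}{1-2\mu}},\ \left[\frac{4\,n\,\kappa_{BBL}}{(1-2\mu)\tau\theta\varsigma^\mu\vartheta^{3/2}}\right]^{\frac1\mu}\right\};$$ (ii) if $\mu=\frac12$,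 $$\frac{1}{k+1}\sum_{j=0}^k\|g_j\|^2\le\frac{\kappa_2}{k+1},$$ $$\kappa_2=\max\left\{\varsigma,\ \frac12 e^{\frac{2\Gamma_0\vartheta\theta^2}{n(\kappa_B+L)}},\ \frac{1}{2\varsigma}\left(\frac{8n\kappa_B(\kappa_B+L)}{\tau\vartheta^{3/2}\theta}\right)^2\left|W_{-1}\left(-\frac{\tau\varsigma\theta\vartheta^{3/2}}{8n\kappa_B(\kappa_B+L)}\right)\right|^2\right\},$$ where $W_{-1}$ is the second real branch of the Lambert function (its argument here being in its domain $[-1/e,0)$); (iii) if $\frac12<\mu<1$, $$\frac{1}{k+1}\sum_{j=0}^k\|g_j\|^2\le\frac{\kappa_3}{k+1},\qquad \kappa_3=\max\left\{\varsigma,\ \left[\frac{2^{1+\mu}\kappa_B}{\tau\varsigma^\mu\sqrt{\vartheta}}\left(\Gamma_0\theta+\frac{n(\kappa_B+L)\varsigma^{1-2\mu}}{2\vartheta\theta(2\mu-1)}\right)\right]^{\frac{1}{1-\mu}}\right\}.$$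
   Context: $\|\cdot\|$ is the Euclidean norm (and the induced norm on matrices). For the iterates $x_k$, write $g_k=g(x_k)=\nabla f(x_k)$; $g_{i,k}$, $s_{i,k}$, $w_{i,k}$ denote the $i$-th components of $g_k,s_k,w_k\in\mathbb{R}^n$. ASTR1 algorithm. Given a starting point $x_0\in\mathbb{R}^n$ and constants $\kappa_B\ge1$ and $\tau\in(0,1]$, for $k=0,1,2,\dots$: 1. Compute $g_k$ and define $\Delta_{i,k}=|g_{i,k}|/w_{i,k}$ for $i\in\{1,\dots,n\}$, where the scaling factors $w_{i,k}>0$ depend on $x_0,\dots,x_k$. 2. Select any symmetric matrix $B_k$ with $\|B_k\|\le\kappa_B$. 3. Compute any step $s_k$ such that $|s_{i,k}|\le\Delta_{i,k}$ for all $i\in\{1,\dots,n\}$ and $$g_k^Ts_k+\tfrac12 s_k^TB_ks_k\le\tau\left(g_k^Ts_k^Q+\tfrac12(s_k^Q)^TB_ks_k^Q\right),$$ where $s_{i,k}^L=-\mathrm{sign}(g_{i,k})\Delta_{i,k}$, $s_k^Q=\gamma_ks_k^L$, and $\gamma_k=\min\left[1,\frac{|g_k^Ts_k^L|}{(s_k^L)^TB_ks_k^L}\right]$ if $(s_k^L)^TB_ks_k^L>0$, $\gamma_k=1$ otherwise. 4. Set $x_{k+1}=x_k+s_k$. The algorithm has no termination rule and generates an infinite sequence. $W_{-1}:[-1/e,0)\to(-\infty,-1]$ is the real branch of the Lambert function characterized by $W_{-1}(y)e^{W_{-1}(y)}=y$ and $W_{-1}(y)\le-1$.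
   Formalization: In case (ii) the argument of W_{-1} lying in [-1/e,0) is assumed rather than claimed: it can fail for large θ (n=1, L=0, κ_B=τ=ς=ϑ=1, θ=8 gives -1), and then W_{-1} and κ_2 are undefined. *)

theory Defs
  imports "HOL-Analysis.Analysis"
begin

(* In each of the following, g is the current gradient, w the current vector of scaling
   factors and B the current matrix. *)

definition astr1_Delta :: "real^'n \<Rightarrow> real^'n \<Rightarrow> real^'n" where
  "astr1_Delta g w = (\<chi> i. \<bar>g $ i\<bar> / w $ i)"

definition astr1_sL :: "real^'n \<Rightarrow> real^'n \<Rightarrow> real^'n" where
  "astr1_sL g w = (\<chi> i. - sgn (g $ i) * astr1_Delta g w $ i)"

definition astr1_gamma :: "real^'n \<Rightarrow> real^'n \<Rightarrow> real^'n^'n \<Rightarrow> real" where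
  "astr1_gamma g w B =
     (let sL = astr1_sL g w; c = sL \<bullet> (B *v sL)
      in if c > 0 then min 1 (\<bar>g \<bullet> sL\<bar> / c) else 1)"

definition astr1_sQ :: "real^'n \<Rightarrow> real^'n \<Rightarrow> real^'n^'n \<Rightarrow> real^'n" where
  "astr1_sQ g w B = astr1_gamma g w B *\<^sub>R astr1_sL g w"

definition astr1_model :: "real^'n \<Rightarrow> real^'n^'n \<Rightarrow> real^'n \<Rightarrow> real" where
  "astr1_model g B s = g \<bullet> s + 1/2 * (s \<bullet> (B *v s))"

(* The sequences x, w, B, s record one run of the algorithm with gradient map g.  The algorithm
   leaves the choices of w_k, B_k and s_k open, so they are arbitrary sequences subject to the
   listed conditions.  That w_k is determined by x_0, ..., x_k needs no separate clause: along a
   single run, indexed by k, every sequence w_k is a function of the prefixes (x_0, ..., x_k). *)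

definition astr1_run ::
  "(real^'n \<Rightarrow> real^'n) \<Rightarrow> real \<Rightarrow> real \<Rightarrow> (nat \<Rightarrow> real^'n) \<Rightarrow> (nat \<Rightarrow> real^'n) \<Rightarrow>
   (nat \<Rightarrow> real^'n^'n) \<Rightarrow> (nat \<Rightarrow> real^'n) \<Rightarrow> bool" where
  "astr1_run g \<kappa>B \<tau> x w B s \<longleftrightarrow>
     (\<forall>k.
        (\<forall>i. w k $ i > 0) \<and>
        transpose (B k) = B k \<and> onorm ((*v) (B k)) \<le> \<kappa>B \<and>
        (\<forall>i. \<bar>s k $ i\<bar> \<le> astr1_Delta (g (x k)) (w k) $ i) \<and>
        astr1_model (g (x k)) (B k) (s k)
          \<le> \<tau> * astr1_model (g (x k)) (B k) (astr1_sQ (g (x k)) (w k) (B k)) \<and>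
        x (Suc k) = x k + s k)"

(* The branch of the Lambert function with values in (-\<infinity>, -1]; the description is unique
   exactly for y in [-1/e, 0), and the value is unspecified for other y. *)

definition lambert_Wm1 :: "real \<Rightarrow> real" where
  "lambert_Wm1 y = (THE w. w * exp w = y \<and> w \<le> -1)"

end

theory Submission
  imports Defs "HOL-Real_Asymp.Real_Asymp"
begin

text \<open>
  Comparing the model decrease at \<open>astr1_sQ\<close> with that at \<open>p\<close> times \<open>astr1_sL\<close>, where
  \<open>p = sqrt vartheta * varsigma powr \<mu> / \<kappa>B\<close>, gives for each step
  \[ f(x_{k+1}) \le f(x_k) - \tau p \sum_i g_{i,k}^2 / w_{i,k} + (\kappa_B + L) \sum_i g_{i,k}^2 / w_{i,k}^2 . \]
  The usual route through the exact Cauchy decrease and the lower bound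
  \<open>sqrt vartheta * \<theta> * varsigma powr \<mu>\<close> on the scaling factors has the right constants only for
  \<open>\<theta> \<ge> 1\<close>. Summed over the iterations, the linear terms are at least a multiple of
  \<open>S / (varsigma + S) powr \<mu>\<close>, where \<open>S\<close> is the sum of the squared gradient norms, and the quadratic
  terms are controlled coordinatewise by the integral of \<open>t powr (- 2 * \<mu>)\<close> from \<open>varsigma\<close> to
  \<open>varsigma + S\<close>. The resulting scalar inequality bounds \<open>S\<close> in each of the three regimes.
\<close>

section \<open>Descent along a step and norm estimates\<close>

text \<open>Along the segment from \<open>x\<close> to \<open>x + s\<close>, subtract the claimed
  quadratic upper model from \<open>f\<close>. By Cauchy-Schwarz and the Lipschitz bound, the
  difference \<open>\<phi>\<close> has nonpositive derivative on the unit interval, so comparing its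
  endpoints suffices.\<close>

lemma GDERIV_lipschitz_descent:
  fixes f :: "'a::euclidean_space \<Rightarrow> real"
  assumes f: "\<And>y. GDERIV f y :> g y" and g: "L-lipschitz_on UNIV g"
  shows "f (x + s) \<le> f x + g x \<bullet> s + L / 2 * (norm s)\<^sup>2"
proof -
  define \<phi> where "\<phi> t = f (x + t *\<^sub>R s) - t * (g x \<bullet> s) - L / 2 * t\<^sup>2 * (norm s)\<^sup>2" for t
  have "\<phi> 1 \<le> \<phi> 0"
  proof (rule DERIV_nonpos_imp_nonincreasing[where f = \<phi> and a = 0 and b = 1])
    fix t :: real assume "0 \<le> t"
    have "(f has_derivative (\<lambda>h. h \<bullet> g (x + t *\<^sub>R s))) (at (x + t *\<^sub>R s))"
      using f[of "x + t *\<^sub>R s"] by (simp add: gderiv_def)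
    then have "((\<lambda>t. f (x + t *\<^sub>R s)) has_derivative (\<lambda>h. (h *\<^sub>R s) \<bullet> g (x + t *\<^sub>R s))) (at t)"
      by (rule has_derivative_compose[rotated]) (auto intro!: derivative_eq_intros)
    then have "((\<lambda>t. f (x + t *\<^sub>R s)) has_real_derivative (g (x + t *\<^sub>R s) \<bullet> s)) (at t)"
      by (simp add: has_field_derivative_def inner_commute mult.commute[of _ "_ \<bullet> _"])
    then have der: "(\<phi> has_real_derivative (g (x + t *\<^sub>R s) \<bullet> s - g x \<bullet> s - L * t * (norm s)\<^sup>2)) (at t)"
      unfolding \<phi>_def by (auto intro!: derivative_eq_intros)
    have "(g (x + t *\<^sub>R s) - g x) \<bullet> s \<le> norm (g (x + t *\<^sub>R s) - g x) * norm s"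
      by (rule norm_cauchy_schwarz)
    also have "\<dots> \<le> (L * (t * norm s)) * norm s"
      using lipschitz_onD[OF g, of "x + t *\<^sub>R s" x] \<open>0 \<le> t\<close>
      by (intro mult_right_mono) (auto simp: dist_norm)
    finally show "\<exists>y. (\<phi> has_real_derivative y) (at t) \<and> y \<le> 0"
      using der by (auto simp: inner_diff_left power2_eq_square algebra_simps)
  qed simp
  then show ?thesis by (simp add: \<phi>_def)
qed

lemma quadratic_form_bound:
  fixes B :: "real^'n^'n"
  assumes "onorm ((*v) B) \<le> \<kappa>"
  shows "\<bar>s \<bullet> (B *v s)\<bar> \<le> \<kappa> * (norm s)\<^sup>2"
proof -
  have "\<bar>s \<bullet> (B *v s)\<bar> \<le> norm s * norm (B *v s)"
    by (rule Cauchy_Schwarz_ineq2)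
  also have "\<dots> \<le> norm s * (\<kappa> * norm s)"
    using order_trans[OF onorm[OF matrix_vector_mul_bounded_linear, of B s] mult_right_mono[OF assms norm_ge_zero]]
    by (intro mult_left_mono) auto
  finally show ?thesis by (simp add: power2_eq_square mult_ac)
qed

lemma norm_power2_vec: "(norm (v :: real^'n))\<^sup>2 = (\<Sum>i\<in>UNIV. (v $ i)\<^sup>2)"
  unfolding power2_norm_eq_inner inner_vec_def by (simp add: power2_eq_square)

section \<open>The reference steps and the decrease in one iteration\<close>

lemma astr1_sL_nth: "astr1_sL g w $ i = - (g $ i / w $ i)"
  by (simp add: astr1_sL_def astr1_Delta_def flip: times_divide_eq_right) (simp add: sgn_mult_abs flip: mult.assoc)

lemma inner_astr1_sL: "g \<bullet> astr1_sL g w = - (\<Sum>i\<in>UNIV. (g $ i)\<^sup>2 / w $ i)"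
  by (simp add: inner_vec_def astr1_sL_nth power2_eq_square sum_negf)

lemma norm_astr1_sL: "(norm (astr1_sL g w))\<^sup>2 = (\<Sum>i\<in>UNIV. (g $ i)\<^sup>2 / (w $ i)\<^sup>2)"
  by (simp add: norm_power2_vec astr1_sL_nth power_divide)

text \<open>\<open>astr1_gamma\<close> minimises the model along \<open>astr1_sL\<close> over the unit interval.\<close>

lemma astr1_model_sQ_le:
  fixes g w :: "real^'n"
  assumes w: "\<And>i. w $ i > 0" and \<gamma>: "0 \<le> \<gamma>" "\<gamma> \<le> 1"
  shows "astr1_model g B (astr1_sQ g w B) \<le> astr1_model g B (\<gamma> *\<^sub>R astr1_sL g w)"
proof -
  define a where "a = - (g \<bullet> astr1_sL g w)"
  define c where "c = astr1_sL g w \<bullet> (B *v astr1_sL g w)"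
  have a: "0 \<le> a"
    using w by (auto simp: a_def inner_astr1_sL less_imp_le intro!: sum_nonneg)
  have model: "astr1_model g B (t *\<^sub>R astr1_sL g w) = - t * a + t\<^sup>2 * c / 2" for t
    by (simp add: astr1_model_def a_def c_def matrix_vector_mult_scaleR power2_eq_square)
  have gam: "astr1_gamma g w B = (if c > 0 then min 1 (a / c) else 1)"
    using a by (simp add: astr1_gamma_def Let_def a_def c_def)
  \<comment> \<open>The first case has its minimiser \<open>a / c\<close> inside the interval. The
    second collects nonpositive curvature and a minimiser at or beyond 1; both give
    \<open>astr1_gamma\<close> the value 1.\<close>
  consider "c > 0" "a \<le> c" | "c \<le> a"
    using a by linarith
  then have "- astr1_gamma g w B * a + (astr1_gamma g w B)\<^sup>2 * c / 2 \<le> - \<gamma> * a + \<gamma>\<^sup>2 * c / 2"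
  proof cases
    case 1
    then have "astr1_gamma g w B = a / c"
      by (simp add: gam)
    \<comment> \<open>Completing the square around the minimiser \<open>a / c\<close>.\<close>
    moreover have "- \<gamma> * a + \<gamma>\<^sup>2 * c / 2 - (- (a / c) * a + (a / c)\<^sup>2 * c / 2) = (a - \<gamma> * c)\<^sup>2 / (2 * c)"
      using 1 by (simp add: divide_simps power2_eq_square) (simp add: algebra_simps)
    moreover have "0 \<le> (a - \<gamma> * c)\<^sup>2 / (2 * c)"
      using 1 by simp
    ultimately show ?thesis
      by simp
  next
    case 2
    then have g1: "astr1_gamma g w B = 1"
      by (simp add: gam)
    \<comment> \<open>The model value at \<open>\<gamma>\<close> minus that at 1 factors as
      \<open>(1 - \<gamma>) * (2 * a - (1 + \<gamma>) * c) / 2\<close>, so the sign of the second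
      factor decides.\<close>
    have "(1 + \<gamma>) * c \<le> 2 * a"
    proof (cases "c \<ge> 0")
      case True
      then have "(1 + \<gamma>) * c \<le> 2 * c" using \<gamma> by (intro mult_right_mono) auto
      then show ?thesis using 2 by simp
    next
      case False
      then have "(1 + \<gamma>) * c \<le> 0" using \<gamma> by (intro mult_nonneg_nonpos) auto
      then show ?thesis using a by linarith
    qed
    then have "0 \<le> (1 - \<gamma>) * (2 * a - (1 + \<gamma>) * c)"
      using \<gamma> by (intro mult_nonneg_nonneg) auto
    then show ?thesis
      by (simp add: g1 power2_eq_square algebra_simps)
  qed
  then show ?thesis
    by (simp add: astr1_sQ_def model)
qed

text \<open>The model at \<open>astr1_sQ\<close> is at most the model at \<open>p\<close> times
  \<open>astr1_sL\<close>. Both \<open>s\<close> and \<open>astr1_sL\<close> have squared norm at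
  most the sum of \<open>(g x $ i)\<^sup>2 / (w $ i)\<^sup>2\<close>, so each of the two curvature
  terms costs at most \<open>\<kappa> / 2\<close> times that sum, and the Lipschitz remainder is
  covered by \<open>L\<close> times it.\<close>

lemma astr1_step_decrease:
  fixes f :: "real^'n \<Rightarrow> real"
  assumes f: "\<And>y. GDERIV f y :> g y" and g: "L-lipschitz_on UNIV g"
    and w: "\<And>i. w $ i > 0" and B: "onorm ((*v) B) \<le> \<kappa>" and "0 \<le> \<tau>" "\<tau> \<le> 1"
    and s: "\<And>i. \<bar>s $ i\<bar> \<le> astr1_Delta (g x) w $ i"
    and m: "astr1_model (g x) B s \<le> \<tau> * astr1_model (g x) B (astr1_sQ (g x) w B)"
    and p: "0 \<le> p" "p \<le> 1"
  shows "f (x + s) \<le> f x - \<tau> * p * (\<Sum>i\<in>UNIV. (g x $ i)\<^sup>2 / w $ i)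
           + (\<kappa> + L) * (\<Sum>i\<in>UNIV. (g x $ i)\<^sup>2 / (w $ i)\<^sup>2)"
proof -
  define a where "a = (\<Sum>i\<in>UNIV. (g x $ i)\<^sup>2 / w $ i)"
  define c where "c = (\<Sum>i\<in>UNIV. (g x $ i)\<^sup>2 / (w $ i)\<^sup>2)"
  have \<kappa>: "0 \<le> \<kappa>"
    using onorm_pos_le[OF matrix_vector_mul_bounded_linear, of B] B by linarith
  have L: "0 \<le> L" using g by (rule lipschitz_on_nonneg)
  have c: "0 \<le> c" by (auto simp: c_def intro!: sum_nonneg)
  have sc: "(norm s)\<^sup>2 \<le> c"
    unfolding norm_power2_vec c_def
  proof (rule sum_mono)
    fix i
    have "\<bar>s $ i\<bar>\<^sup>2 \<le> (\<bar>g x $ i\<bar> / w $ i)\<^sup>2"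
      using s[of i] by (intro power_mono) (auto simp: astr1_Delta_def)
    then show "(s $ i)\<^sup>2 \<le> (g x $ i)\<^sup>2 / (w $ i)\<^sup>2"
      by (simp add: power_divide)
  qed
  have "astr1_model (g x) B (astr1_sQ (g x) w B) \<le> astr1_model (g x) B (p *\<^sub>R astr1_sL (g x) w)"
    using w p by (rule astr1_model_sQ_le)
  also have "\<dots> = - p * a + p\<^sup>2 / 2 * (astr1_sL (g x) w \<bullet> (B *v astr1_sL (g x) w))"
    by (simp add: astr1_model_def inner_astr1_sL a_def matrix_vector_mult_scaleR power2_eq_square)
  also have "\<dots> \<le> - p * a + p\<^sup>2 / 2 * (\<kappa> * c)"
    using quadratic_form_bound[OF B, of "astr1_sL (g x) w"]
    by (intro add_left_mono mult_left_mono) (auto simp: norm_astr1_sL c_def)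
  \<comment> \<open>Here \<open>p\<^sup>2\<close> is replaced by 1, so only the linear term keeps
    \<open>p\<close>.\<close>
  also have "\<dots> \<le> - p * a + \<kappa> * c / 2"
    using p \<kappa> c mult_right_mono[of "p\<^sup>2" 1 "\<kappa> * c"] by (simp add: power_le_one)
  finally have "\<tau> * astr1_model (g x) B (astr1_sQ (g x) w B) \<le> \<tau> * (- p * a + \<kappa> * c / 2)"
    using \<open>0 \<le> \<tau>\<close> by (rule mult_left_mono)
  also have "\<dots> \<le> - \<tau> * p * a + \<kappa> * c / 2"
    using \<open>\<tau> \<le> 1\<close> \<kappa> c mult_right_mono[of \<tau> 1 "\<kappa> * c"] by (simp add: algebra_simps)
  finally have "astr1_model (g x) B s \<le> - \<tau> * p * a + \<kappa> * c / 2"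
    using m by linarith
  moreover have "- (\<kappa> * c / 2) \<le> 1 / 2 * (s \<bullet> (B *v s))"
    using quadratic_form_bound[OF B, of s] mult_left_mono[OF sc \<kappa>] by (simp add: abs_le_iff)
  ultimately have "g x \<bullet> s \<le> - \<tau> * p * a + \<kappa> * c"
    by (simp add: astr1_model_def)
  moreover have "f (x + s) \<le> f x + g x \<bullet> s + L / 2 * (norm s)\<^sup>2"
    using f g by (rule GDERIV_lipschitz_descent)
  moreover have "L / 2 * (norm s)\<^sup>2 \<le> L / 2 * c" "0 \<le> L / 2 * c"
    using sc L c by (auto intro: mult_left_mono)
  ultimately show ?thesis
    unfolding a_def[symmetric] c_def[symmetric] by (simp add: algebra_simps)
qed

section \<open>Summation of the decreases over the iterations\<close>

text \<open>With increments \<open>a j\<close> the left side is a right-endpoint Riemann sum, and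
  \<open>\<Phi>\<close> acts as an antiderivative of a decreasing \<open>\<phi>\<close>. The inner
  sum includes the index \<open>j\<close> itself, as the scaling factors do; this selects the right
  endpoint.\<close>

lemma sum_le_telescope:
  fixes a :: "nat \<Rightarrow> real"
  assumes \<phi>: "\<And>y z. 0 < y \<Longrightarrow> y \<le> z \<Longrightarrow> (z - y) * \<phi> z \<le> \<Phi> z - \<Phi> y"
    and "0 < \<sigma>" and a: "\<And>j. 0 \<le> a j"
  shows "(\<Sum>j=0..k. a j * \<phi> (\<sigma> + (\<Sum>l=0..j. a l))) \<le> \<Phi> (\<sigma> + (\<Sum>l=0..k. a l)) - \<Phi> \<sigma>"
proof (induction k)
  case 0
  then show ?case using \<phi>[of \<sigma> "\<sigma> + a 0"] \<open>0 < \<sigma>\<close> a[of 0] by simp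
next
  case (Suc k)
  have "0 \<le> (\<Sum>l=0..k. a l)" by (simp add: a sum_nonneg)
  then show ?case
    using Suc \<phi>[of "\<sigma> + (\<Sum>l=0..k. a l)" "\<sigma> + (\<Sum>l=0..Suc k. a l)"] \<open>0 < \<sigma>\<close> a[of "Suc k"]
    by (simp add: algebra_simps)
qed

text \<open>Leaving \<open>\<Phi>\<close> abstract lets all three ranges of the exponent share this
  estimate: a power serves away from \<open>\<mu> = 1/2\<close>, the logarithm at it.\<close>

lemma astr1_sum_bound:
  fixes f :: "real^'n \<Rightarrow> real" and x w s :: "nat \<Rightarrow> real^'n"
  defines "n \<equiv> real CARD('n)"
  assumes f: "\<And>y. GDERIV f y :> g y" and g: "L-lipschitz_on UNIV g" and low: "\<And>y. f_low \<le> f y"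
    and \<sigma>: "0 < \<sigma>" "\<sigma> \<le> 1" and \<omega>: "0 < \<omega>" "\<omega> \<le> 1" and \<theta>: "0 < \<theta>" and \<mu>: "0 \<le> \<mu>"
    and \<kappa>: "1 \<le> \<kappa>" and \<tau>: "0 < \<tau>" "\<tau> \<le> 1"
    and run: "astr1_run g \<kappa> \<tau> x w B s"
    and w: "\<And>k i. let v = \<theta> * (\<sigma> + (\<Sum>l=0..k. (g (x l) $ i)\<^sup>2)) powr \<mu>
               in w k $ i \<in> {sqrt \<omega> * v .. v}"
    and \<Phi>: "\<And>y z. 0 < y \<Longrightarrow> y \<le> z \<Longrightarrow> (z - y) * (1 / z powr (2 * \<mu>)) \<le> \<Phi> z - \<Phi> y"
    and \<Phi>_mono: "\<And>y z. 0 < y \<Longrightarrow> y \<le> z \<Longrightarrow> \<Phi> y \<le> \<Phi> z"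
  defines "S \<equiv> \<lambda>k. \<Sum>j=0..k. (norm (g (x j)))\<^sup>2"
  shows "\<tau> * \<omega> powr (3/2) * \<sigma> powr \<mu> * \<theta> / (n * \<kappa> * (\<kappa> + L)) * (S k / (\<sigma> + S k) powr \<mu>)
           \<le> \<omega> * \<theta>\<^sup>2 * (f (x 0) - f_low) / (n * (\<kappa> + L)) + (\<Phi> (\<sigma> + S k) - \<Phi> \<sigma>)"
proof -
  define u where "u k i = \<sigma> + (\<Sum>l=0..k. (g (x l) $ i)\<^sup>2)" for k i
  \<comment> \<open>This value lies in the unit interval because \<open>\<sigma>\<close> and
    \<open>\<omega>\<close> are at most 1 and \<open>\<kappa>\<close> is at least 1. Its
    \<open>sqrt \<omega>\<close> meets the factor \<open>\<omega>\<close> of the later normalisation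
    and gives \<open>\<omega> powr (3/2)\<close>.\<close>
  define p where "p = sqrt \<omega> * \<sigma> powr \<mu> / \<kappa>"
  define A where "A = (\<Sum>j=0..k. \<Sum>i\<in>UNIV. (g (x j) $ i)\<^sup>2 / w j $ i)"
  define C where "C = (\<Sum>j=0..k. \<Sum>i\<in>UNIV. (g (x j) $ i)\<^sup>2 / (w j $ i)\<^sup>2)"
  have L: "0 \<le> L" using g by (rule lipschitz_on_nonneg)
  have n: "0 < n" by (simp add: n_def)
  have w_le: "w k $ i \<le> \<theta> * u k i powr \<mu>" and w_ge: "sqrt \<omega> * \<theta> * u k i powr \<mu> \<le> w k $ i"
    and w_pos: "0 < w k $ i" for k i
    using w[where k = k and i = i] run by (auto simp: Let_def u_def astr1_run_def mult.assoc)
  have u_pos: "0 < u k i" for k i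
    using \<sigma> by (auto simp: u_def intro!: add_pos_nonneg sum_nonneg)
  have S_nonneg: "0 \<le> S k" by (simp add: S_def sum_nonneg)
  have S_sum: "S k = (\<Sum>i\<in>UNIV. \<Sum>l=0..k. (g (x l) $ i)\<^sup>2)" for k
    unfolding S_def norm_power2_vec by (rule sum.swap)
  have u_le: "u j i \<le> \<sigma> + S k" if "j \<le> k" for j i
  proof -
    have "(\<Sum>l=0..j. (g (x l) $ i)\<^sup>2) \<le> (\<Sum>l=0..k. (g (x l) $ i)\<^sup>2)"
      using that by (intro sum_mono2) auto
    also have "\<dots> \<le> S k"
      unfolding S_sum by (rule member_le_sum) (auto intro: sum_nonneg)
    finally show ?thesis by (simp add: u_def)
  qed
  have "sqrt \<omega> * \<sigma> powr \<mu> \<le> 1"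
    using \<sigma> \<omega> \<mu> by (intro mult_le_one powr_le1) auto
  then have p: "0 \<le> p" "p \<le> 1"
    using \<kappa> \<omega> by (auto simp: p_def)
  have step: "f (x (Suc j)) \<le> f (x j) - \<tau> * p * (\<Sum>i\<in>UNIV. (g (x j) $ i)\<^sup>2 / w j $ i)
           + (\<kappa> + L) * (\<Sum>i\<in>UNIV. (g (x j) $ i)\<^sup>2 / (w j $ i)\<^sup>2)" for j
    using astr1_step_decrease[OF f g, where w = "w j" and B = "B j" and \<kappa> = \<kappa> and \<tau> = \<tau>
        and s = "s j" and x = "x j" and p = p] run p \<tau>
    by (auto simp: astr1_run_def)
  have "f (x (Suc k)) \<le> f (x 0) - \<tau> * p * A + (\<kappa> + L) * C"
    unfolding A_def C_def
  proof (induction k)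
    case (Suc k)
    then show ?case using step[of "Suc k"] by (simp add: algebra_simps)
  qed (use step[of 0] in simp)
  then have main: "\<tau> * p * A \<le> f (x 0) - f_low + (\<kappa> + L) * C"
    using low[of "x (Suc k)"] by linarith
  \<comment> \<open>Every scaling factor up to iteration \<open>k\<close> is at most
    \<open>\<theta> * (\<sigma> + S k) powr \<mu>\<close>; this common denominator bounds
    \<open>A\<close> from below.\<close>
  have "S k / (\<theta> * (\<sigma> + S k) powr \<mu>)
      = (\<Sum>j=0..k. \<Sum>i\<in>UNIV. (g (x j) $ i)\<^sup>2 / (\<theta> * (\<sigma> + S k) powr \<mu>))"
    by (simp add: S_def norm_power2_vec sum_divide_distrib)
  also have "\<dots> \<le> A"
    unfolding A_def
  proof (intro sum_mono)
    fix j i assume "j \<in> {0..k}"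
    then have "w j $ i \<le> \<theta> * (\<sigma> + S k) powr \<mu>"
      using u_le[of j i] u_pos[of j i] \<mu> \<theta>
      by (intro order_trans[OF w_le[of j i]] mult_left_mono powr_mono2) auto
    then show "(g (x j) $ i)\<^sup>2 / (\<theta> * (\<sigma> + S k) powr \<mu>) \<le> (g (x j) $ i)\<^sup>2 / w j $ i"
      using w_pos[of j i] by (intro divide_left_mono) auto
  qed
  finally have A: "S k / (\<theta> * (\<sigma> + S k) powr \<mu>) \<le> A" .
  have "C \<le> (\<Sum>j=0..k. \<Sum>i\<in>UNIV. (g (x j) $ i)\<^sup>2 * (1 / u j i powr (2 * \<mu>)) / (\<omega> * \<theta>\<^sup>2))"
    unfolding C_def
  proof (intro sum_mono)
    fix j i
    have "(sqrt \<omega> * \<theta> * u j i powr \<mu>)\<^sup>2 \<le> (w j $ i)\<^sup>2"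
      using w_ge[of j i] \<theta> \<omega> by (intro power_mono) auto
    then have "\<omega> * \<theta>\<^sup>2 * u j i powr (2 * \<mu>) \<le> (w j $ i)\<^sup>2"
      using \<omega> u_pos[of j i] by (simp add: power_mult_distrib powr_power mult.commute[of \<mu>])
    then have "(g (x j) $ i)\<^sup>2 / (w j $ i)\<^sup>2 \<le> (g (x j) $ i)\<^sup>2 / (\<omega> * \<theta>\<^sup>2 * u j i powr (2 * \<mu>))"
      using w_pos[of j i] u_pos[of j i] \<omega> \<theta> by (intro divide_left_mono mult_pos_pos) auto
    then show "(g (x j) $ i)\<^sup>2 / (w j $ i)\<^sup>2
        \<le> (g (x j) $ i)\<^sup>2 * (1 / u j i powr (2 * \<mu>)) / (\<omega> * \<theta>\<^sup>2)"
      by (simp add: field_simps)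
  qed
  also have "\<dots> = (\<Sum>i\<in>UNIV. \<Sum>j=0..k. (g (x j) $ i)\<^sup>2 * (1 / u j i powr (2 * \<mu>))) / (\<omega> * \<theta>\<^sup>2)"
    by (subst sum.swap) (simp add: sum_divide_distrib)
  \<comment> \<open>Each coordinate telescopes from \<open>\<sigma>\<close> to its own
    \<open>u k i\<close>. Monotonicity of \<open>\<Phi>\<close> enlarges the endpoint to
    \<open>\<sigma> + S k\<close>, and the equal bounds add up to a factor \<open>n\<close>.\<close>
  also have "\<dots> \<le> (\<Sum>i\<in>(UNIV :: 'n set). \<Phi> (\<sigma> + S k) - \<Phi> \<sigma>) / (\<omega> * \<theta>\<^sup>2)"
  proof (intro divide_right_mono sum_mono)
    fix i :: 'n
    have "(\<Sum>j=0..k. (g (x j) $ i)\<^sup>2 * (1 / u j i powr (2 * \<mu>))) \<le> \<Phi> (u k i) - \<Phi> \<sigma>"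
      unfolding u_def
      by (rule sum_le_telescope[where \<phi> = "\<lambda>z. 1 / z powr (2 * \<mu>)"]) (use \<Phi> \<sigma> in auto)
    then show "(\<Sum>j=0..k. (g (x j) $ i)\<^sup>2 * (1 / u j i powr (2 * \<mu>))) \<le> \<Phi> (\<sigma> + S k) - \<Phi> \<sigma>"
      using \<Phi>_mono[OF u_pos u_le[OF order_refl]] by (rule order_trans[OF _ diff_right_mono])
  qed (use \<omega> in auto)
  finally have C: "C \<le> n * (\<Phi> (\<sigma> + S k) - \<Phi> \<sigma>) / (\<omega> * \<theta>\<^sup>2)"
    by (simp add: n_def)
  have "\<tau> * p * (S k / (\<theta> * (\<sigma> + S k) powr \<mu>)) \<le> \<tau> * p * A"
    using A \<tau> p by (intro mult_left_mono) auto
  also note main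
  also have "(\<kappa> + L) * C \<le> (\<kappa> + L) * (n * (\<Phi> (\<sigma> + S k) - \<Phi> \<sigma>) / (\<omega> * \<theta>\<^sup>2))"
    using C \<kappa> L by (intro mult_left_mono) auto
  finally have "\<tau> * p * (S k / (\<theta> * (\<sigma> + S k) powr \<mu>))
      \<le> f (x 0) - f_low + (\<kappa> + L) * (n * (\<Phi> (\<sigma> + S k) - \<Phi> \<sigma>) / (\<omega> * \<theta>\<^sup>2))"
    by simp
  \<comment> \<open>This multiplier gives the increment of \<open>\<Phi>\<close> coefficient
    1.\<close>
  then have "\<omega> * \<theta>\<^sup>2 / (n * (\<kappa> + L)) * (\<tau> * p * (S k / (\<theta> * (\<sigma> + S k) powr \<mu>)))
      \<le> \<omega> * \<theta>\<^sup>2 / (n * (\<kappa> + L)) *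
        (f (x 0) - f_low + (\<kappa> + L) * (n * (\<Phi> (\<sigma> + S k) - \<Phi> \<sigma>) / (\<omega> * \<theta>\<^sup>2)))"
    using \<omega> n \<kappa> L by (intro mult_left_mono) auto
  also have "\<dots> = \<omega> * \<theta>\<^sup>2 * (f (x 0) - f_low) / (n * (\<kappa> + L)) + (\<Phi> (\<sigma> + S k) - \<Phi> \<sigma>)"
    using \<omega> \<theta> n \<kappa> L by (simp add: divide_simps)
  also have "\<omega> * \<theta>\<^sup>2 / (n * (\<kappa> + L)) * (\<tau> * p * (S k / (\<theta> * (\<sigma> + S k) powr \<mu>)))
      = \<tau> * (\<omega> * sqrt \<omega>) * \<sigma> powr \<mu> * \<theta> / (n * \<kappa> * (\<kappa> + L)) * (S k / (\<sigma> + S k) powr \<mu>)"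
    using \<theta> by (simp add: p_def power2_eq_square mult_ac)
  also have "\<omega> * sqrt \<omega> = \<omega> powr (3/2)"
    using \<omega> powr_add[of \<omega> 1 "1/2"] by (simp add: powr_half_sqrt)
  finally show ?thesis .
qed

section \<open>Antiderivatives for the comparison with integrals\<close>

text \<open>The mean value theorem writes the increment as \<open>(z - y) * \<phi> t\<close> with
  \<open>t\<close> between \<open>y\<close> and \<open>z\<close>, and an antitone
  \<open>\<phi>\<close> is smallest at the right end.\<close>

lemma mult_le_diff_if_deriv_antimono:
  fixes \<Phi> \<phi> :: "real \<Rightarrow> real"
  assumes "\<And>t. 0 < t \<Longrightarrow> (\<Phi> has_real_derivative \<phi> t) (at t)"
    and "\<And>t u. 0 < t \<Longrightarrow> t \<le> u \<Longrightarrow> \<phi> u \<le> \<phi> t"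
    and "0 < y" "y \<le> z"
  shows "(z - y) * \<phi> z \<le> \<Phi> z - \<Phi> y"
proof (cases "y = z")
  case False
  with assms have "y < z" by simp
  then obtain t where t: "y < t" "t < z" "\<Phi> z - \<Phi> y = (z - y) * \<phi> t"
    using MVT2[of y z \<Phi> \<phi>] assms by auto
  then show ?thesis using assms(2)[of t z] assms(3) by (auto intro: mult_left_mono)
qed simp

text \<open>With \<open>r = 2 * \<mu>\<close> this supplies \<open>\<Phi>\<close> on both sides of
  the critical exponent, where \<open>ln\<close> takes over.\<close>

lemma has_real_derivative_powr_antiderivative:
  fixes r t :: real
  assumes "r \<noteq> 1" "0 < t"
  shows "((\<lambda>z. z powr (1 - r) / (1 - r)) has_real_derivative 1 / t powr r) (at t)"
  using assms by (auto intro!: derivative_eq_intros simp: powr_minus divide_simps)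

lemma one_over_powr_antimono:
  fixes r t u :: real
  assumes "0 \<le> r" "0 < t" "t \<le> u"
  shows "1 / u powr r \<le> 1 / t powr r"
  using assms by (intro divide_left_mono powr_mono2) auto

lemma le_powr_inverse:
  fixes S E r :: real
  assumes "0 \<le> S" "0 < r" "S powr r \<le> E"
  shows "S \<le> E powr (1 / r)"
proof -
  have "S = (S powr r) powr (1 / r)" using assms by (simp add: powr_powr)
  also have "\<dots> \<le> E powr (1 / r)" using assms by (intro powr_mono2) auto
  finally show ?thesis .
qed

section \<open>The scalar inequality away from the critical exponent\<close>

text \<open>If \<open>S\<close> exceeded all three terms, the first would give
  \<open>\<sigma> + S \<le> 2 * S\<close> and the second would absorb \<open>G\<close> into the
  power term. What remains bounds \<open>S powr \<mu>\<close> by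
  \<open>4 / ((1 - 2 * \<mu>) * P)\<close>, against the third.\<close>

lemma bound_subcritical:
  fixes S \<sigma> \<mu> P G :: real
  assumes \<mu>: "0 < \<mu>" "\<mu> < 1/2" and P: "0 < P" and \<sigma>: "0 < \<sigma>" and S: "0 \<le> S"
    and ineq: "P * (S / (\<sigma> + S) powr \<mu>)
      \<le> G + ((\<sigma> + S) powr (1 - 2 * \<mu>) / (1 - 2 * \<mu>) - \<sigma> powr (1 - 2 * \<mu>) / (1 - 2 * \<mu>))"
  shows "S \<le> max \<sigma> (max ((2 powr (2 * \<mu>) * (1 - 2 * \<mu>) * G) powr (1 / (1 - 2 * \<mu>)))
      ((4 / ((1 - 2 * \<mu>) * P)) powr (1 / \<mu>)))"
proof (rule ccontr)
  assume "\<not> ?thesis"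
  then have S\<sigma>: "\<sigma> < S" and S2: "\<not> S \<le> (2 powr (2 * \<mu>) * (1 - 2 * \<mu>) * G) powr (1 / (1 - 2 * \<mu>))"
    and S3: "\<not> S \<le> (4 / ((1 - 2 * \<mu>) * P)) powr (1 / \<mu>)"
    by auto
  define c where "c = 1 - 2 * \<mu>"
  have c: "0 < c" using \<mu> by (simp add: c_def)
  have G: "2 powr (2 * \<mu>) * c * G < S powr c"
    using S2 le_powr_inverse[of S c "2 powr (2 * \<mu>) * c * G"] c S unfolding c_def by linarith
  have SP: "4 / (c * P) < S powr \<mu>"
    using S3 le_powr_inverse[of S \<mu> "4 / (c * P)"] \<mu> S unfolding c_def by linarith
  \<comment> \<open>The exponents \<open>c\<close> and \<open>2 * \<mu>\<close> add up to 1. This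
    explains the factor \<open>2 powr (2 * \<mu>)\<close> in the second term: it lets
    \<open>c * G\<close> be compared with \<open>(2 * S) powr c\<close>.\<close>
  have two: "2 powr c * 2 powr (2 * \<mu>) = 2"
    by (simp add: c_def flip: powr_add)
  have "P * (S / (2 * S) powr \<mu>) \<le> P * (S / (\<sigma> + S) powr \<mu>)"
    using P S\<sigma> \<sigma> \<mu> by (intro mult_left_mono divide_left_mono powr_mono2) auto
  also note ineq
  also have "(\<sigma> + S) powr (1 - 2 * \<mu>) / (1 - 2 * \<mu>) - \<sigma> powr (1 - 2 * \<mu>) / (1 - 2 * \<mu>) \<le> (2 * S) powr c / c"
  proof -
    have "(\<sigma> + S) powr c / c \<le> (2 * S) powr c / c" "0 \<le> \<sigma> powr c / c"
      using S\<sigma> \<sigma> c by (auto intro!: divide_right_mono powr_mono2)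
    then show ?thesis unfolding c_def by linarith
  qed
  finally have "c * (P * (S / (2 * S) powr \<mu>)) \<le> c * G + (2 * S) powr c"
    using c by (simp add: field_simps)
  moreover have "c * G \<le> (2 * S) powr c"
  proof -
    have "2 * (c * G) = 2 powr c * (2 powr (2 * \<mu>) * c * G)"
      using two by (simp add: mult.assoc[symmetric])
    also have "\<dots> \<le> 2 powr c * S powr c"
      using G by (intro mult_left_mono) auto
    also have "\<dots> = (2 * S) powr c"
      using S by (simp add: powr_mult)
    finally have "2 * (c * G) \<le> (2 * S) powr c" .
    moreover have "0 \<le> (2 * S) powr c" by simp
    ultimately show ?thesis by linarith
  qed
  ultimately have "c * (P * (S / (2 * S) powr \<mu>)) \<le> 2 * (2 * S) powr c"
    by linarith
  then have "c * (P * (S / (2 * S) powr \<mu>)) * (2 * S) powr \<mu> \<le> 2 * (2 * S) powr c * (2 * S) powr \<mu>"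
    by (rule mult_right_mono) simp
  then have "c * P * S \<le> 2 * (2 * S) powr (1 - \<mu>)"
    using S\<sigma> \<sigma> by (simp add: c_def mult.assoc flip: powr_add)
  \<comment> \<open>As \<open>2 powr (1 - \<mu>)\<close> is at most 2, the constant becomes
    4.\<close>
  also have "\<dots> \<le> 4 * S powr (1 - \<mu>)"
    using S \<mu> mult_right_mono[OF powr_mono[of "1 - \<mu>" 1 "2::real"], of "S powr (1 - \<mu>)"]
    by (simp add: powr_mult mult.commute)
  finally have "c * P * S powr \<mu> * S powr (1 - \<mu>) \<le> 4 * S powr (1 - \<mu>)"
    using S\<sigma> \<sigma> by (simp add: mult.assoc flip: powr_add)
  then have "c * P * S powr \<mu> \<le> 4"
    using S\<sigma> \<sigma> by simp
  then show False
    using SP c P by (simp add: field_simps)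
qed

text \<open>The exponent \<open>1 - 2 * \<mu>\<close> is negative, so the increment of the
  antiderivative stays below a constant depending only on \<open>\<sigma>\<close> and
  \<open>\<mu>\<close>. For \<open>S > \<sigma>\<close> the left side is at least a multiple of
  \<open>S powr (1 - \<mu>)\<close>, which bounds \<open>S\<close> directly.\<close>

lemma bound_supercritical:
  fixes S \<sigma> \<mu> P G :: real
  assumes \<mu>: "1/2 < \<mu>" "\<mu> < 1" and P: "0 < P" and G: "0 \<le> G" and \<sigma>: "0 < \<sigma>" and S: "0 \<le> S"
    and ineq: "P * (S / (\<sigma> + S) powr \<mu>)
      \<le> G + ((\<sigma> + S) powr (1 - 2 * \<mu>) / (1 - 2 * \<mu>) - \<sigma> powr (1 - 2 * \<mu>) / (1 - 2 * \<mu>))"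
  shows "S \<le> max \<sigma> ((2 powr (1 + \<mu>) / P * (G + \<sigma> powr (1 - 2 * \<mu>) / (2 * (2 * \<mu> - 1)))) powr (1 / (1 - \<mu>)))"
proof (cases "S \<le> \<sigma>")
  case False
  define X where "X = \<sigma> powr (1 - 2 * \<mu>) / (2 * \<mu> - 1)"
  have "P * (S / (2 * S) powr \<mu>) \<le> P * (S / (\<sigma> + S) powr \<mu>)"
    using P False \<sigma> \<mu> by (intro mult_left_mono divide_left_mono powr_mono2) auto
  also note ineq
  also have "(\<sigma> + S) powr (1 - 2 * \<mu>) / (1 - 2 * \<mu>) - \<sigma> powr (1 - 2 * \<mu>) / (1 - 2 * \<mu>) \<le> X"
  proof -
    have "(\<sigma> + S) powr (1 - 2 * \<mu>) / (1 - 2 * \<mu>) \<le> 0"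
      using \<mu> by (intro divide_nonneg_neg) auto
    moreover have "X = - (\<sigma> powr (1 - 2 * \<mu>) / (1 - 2 * \<mu>))"
      unfolding X_def minus_divide_right by simp
    ultimately show ?thesis by linarith
  qed
  \<comment> \<open>Doubling the nonnegative \<open>G\<close> allows a factor 2 to be taken out; it
    turns \<open>2 powr \<mu>\<close> into \<open>2 powr (1 + \<mu>)\<close>.\<close>
  finally have "P * (S / (2 * S) powr \<mu>) \<le> 2 * (G + X / 2)"
    using G by simp
  then have "2 powr \<mu> / P * (P * (S / (2 * S) powr \<mu>)) \<le> 2 powr \<mu> / P * (2 * (G + X / 2))"
    using P by (intro mult_left_mono) auto
  moreover have "2 powr \<mu> / P * (P * (S / (2 * S) powr \<mu>)) = S powr (1 - \<mu>)"
    using P S False \<sigma> by (simp add: powr_mult powr_diff)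
  moreover have "2 powr \<mu> / P * (2 * (G + X / 2)) = 2 powr (1 + \<mu>) / P * (G + X / 2)"
    by (simp add: powr_add)
  ultimately have "S powr (1 - \<mu>) \<le> 2 powr (1 + \<mu>) / P * (G + X / 2)"
    by linarith
  then have "S \<le> (2 powr (1 + \<mu>) / P * (G + X / 2)) powr (1 / (1 - \<mu>))"
    using S \<mu> by (intro le_powr_inverse) auto
  then show ?thesis by (simp add: X_def mult.commute)
qed simp

section \<open>The lower Lambert branch and the critical exponent\<close>

text \<open>After division by \<open>exp v\<close> the claim reads
  \<open>- v < - w * exp (w - v)\<close>. It follows from \<open>1 + h < exp h\<close> at
  \<open>h = w - v\<close>; the leftover term \<open>(w - v) * (- w - 1)\<close> is nonnegative
  because \<open>w \<le> -1\<close>.\<close>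

lemma mult_exp_strict_antimono:
  fixes v w :: real
  assumes "v < w" "w \<le> -1"
  shows "w * exp w < v * exp v"
proof -
  have "- v < - w * exp (w - v)"
  proof -
    have "1 + (w - v) < exp (w - v)"
      using assms exp_minus_greater[of "v - w"] by simp
    then have "- w * (1 + (w - v)) < - w * exp (w - v)"
      using assms by (intro mult_strict_left_mono) auto
    moreover have "0 \<le> (w - v) * (- w - 1)"
      using assms by (intro mult_nonneg_nonneg) auto
    ultimately show ?thesis by (simp add: algebra_simps)
  qed
  then have "- v * exp v < - w * exp (w - v) * exp v"
    by (rule mult_strict_right_mono) simp
  then show ?thesis by (simp add: mult.assoc flip: exp_add)
qed

text \<open>Makes the definite description usable. The function \<open>w * exp w\<close> tends to 0
  at minus infinity and is \<open>- (1 / exp 1)\<close> at -1, so the intermediate value theorem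
  gives existence; strict monotonicity gives uniqueness.\<close>

lemma lambert_Wm1:
  assumes "- (1 / exp 1) \<le> y" "y < 0"
  shows "lambert_Wm1 y * exp (lambert_Wm1 y) = y" "lambert_Wm1 y \<le> -1"
proof -
  have "((\<lambda>w::real. w * exp w) \<longlongrightarrow> 0) at_bot"
    by real_asymp
  then have "eventually (\<lambda>w::real. y < w * exp w) at_bot"
    using assms by (intro order_tendstoD) auto
  then obtain a where a: "y < a * exp a" "a \<le> -1"
    using eventually_happens[OF eventually_conj[OF _ eventually_le_at_bot[of "-1"]]] by force
  have "\<exists>w. a \<le> w \<and> w \<le> -1 \<and> w * exp w = y"
    using a assms by (intro IVT2') (auto intro!: continuous_intros simp: exp_minus field_simps)
  then have "\<exists>!w. w * exp w = y \<and> w \<le> -1"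
    using mult_exp_strict_antimono by (metis linorder_neqE_linordered_idom less_irrefl)
  from theI'[OF this] show "lambert_Wm1 y * exp (lambert_Wm1 y) = y" "lambert_Wm1 y \<le> -1"
    unfolding lambert_Wm1_def by blast+
qed

text \<open>In terms of \<open>r = sqrt (2 * S / \<sigma>)\<close>, a counterexample satisfies
  \<open>q * r \<le> ln r\<close>. The larger root of \<open>q * r = ln r\<close> is
  \<open>exp (- W) = \<bar>W\<bar> / q\<close>, with \<open>W\<close> the Lambert value at
  \<open>- q\<close>, and the third term of the maximum places \<open>r\<close> beyond it.\<close>

lemma bound_critical:
  fixes S \<sigma> P G q :: real
  defines "q \<equiv> P * sqrt \<sigma> / 8"
  assumes P: "0 < P" and \<sigma>: "0 < \<sigma>" "\<sigma> \<le> 1" and S: "0 \<le> S" and q: "q \<le> 1 / exp 1"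
    and ineq: "P * (S / sqrt (\<sigma> + S)) \<le> G + (ln (\<sigma> + S) - ln \<sigma>)"
  shows "S \<le> max \<sigma> (max (1/2 * exp (2 * G)) (1 / (2 * \<sigma>) * (\<sigma> / q)\<^sup>2 * \<bar>lambert_Wm1 (- q)\<bar>\<^sup>2))"
proof (rule ccontr)
  define W where "W = lambert_Wm1 (- q)"
  define r where "r = sqrt (2 * S / \<sigma>)"
  assume "\<not> ?thesis"
  then have S\<sigma>: "\<sigma> < S" and S2: "exp (2 * G) < 2 * S" 
    and S3: "1 / (2 * \<sigma>) * (\<sigma> / q)\<^sup>2 * \<bar>W\<bar>\<^sup>2 < S"
    by (auto simp: W_def)
  have q0: "0 < q" using P \<sigma> by (simp add: q_def)
  have W: "W * exp W = - q" "W \<le> -1"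
    using lambert_Wm1[of "- q"] q q0 by (auto simp: W_def)
  have r_pos: "0 < r" and r2: "r\<^sup>2 = 2 * S / \<sigma>"
    using S\<sigma> \<sigma> by (auto simp: r_def)
  have lnr: "ln (2 * S / \<sigma>) = 2 * ln r"
    using r_pos by (simp add: ln_realpow flip: r2)
  have "2 * G < ln (2 * S)"
    using S2 S\<sigma> \<sigma> by (metis exp_gt_zero ln_exp ln_less_cancel_iff order_less_trans)
  \<comment> \<open>Uses \<open>\<sigma> \<le> 1\<close>, so that \<open>2 * S\<close> is at most
    \<open>r\<^sup>2\<close>.\<close>
  also have "\<dots> \<le> 2 * ln r"
    unfolding lnr[symmetric] using S\<sigma> \<sigma> by (subst ln_le_cancel_iff) (auto simp: field_simps)
  finally have G: "G \<le> ln r" by simp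
  have "P * (S / sqrt (2 * S)) \<le> P * (S / sqrt (\<sigma> + S))"
    using P S\<sigma> \<sigma> by (intro mult_left_mono divide_left_mono) auto
  also note ineq
  also have "ln (\<sigma> + S) - ln \<sigma> \<le> 2 * ln r"
    unfolding lnr[symmetric] using S\<sigma> \<sigma> by (simp add: ln_div)
  also have "P * (S / sqrt (2 * S)) = 4 * q * r"
    using S\<sigma> \<sigma> by (simp add: q_def r_def real_sqrt_divide real_sqrt_mult field_simps)
  \<comment> \<open>One \<open>ln r\<close> comes from \<open>G\<close> and two from the difference
    of logarithms.\<close>
  finally have "4 * (q * r) \<le> 3 * ln r"
    using G by simp
  moreover have "0 < q * r" using q0 r_pos by simp
  ultimately have qr: "q * r \<le> ln r"
    by linarith
  have "(\<bar>W\<bar> / q)\<^sup>2 < r\<^sup>2"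
    using S3 \<sigma> q0 unfolding r2 by (simp add: field_simps power2_eq_square)
  then have "\<bar>W\<bar> / q < r"
    using r_pos by (simp add: power_less_imp_less_base)
  moreover have "\<bar>W\<bar> / q = exp (- W)"
    using W q0 by (simp add: exp_minus field_simps)
  ultimately have "- W < ln r"
    using r_pos by (metis exp_less_cancel_iff exp_ln)
  \<comment> \<open>Strict monotonicity on the branch, at \<open>- ln r < W\<close>, yields
    \<open>ln r / r < q\<close>.\<close>
  then have "W * exp W < (- ln r) * exp (- ln r)"
    using W by (intro mult_exp_strict_antimono) auto
  then show False
    using qr r_pos W by (simp add: exp_minus field_simps)
qed

section \<open>The three rates from the scalar bounds\<close>

theorem theorem3p2:
  fixes f :: "real^'n \<Rightarrow> real" and g :: "real^'n \<Rightarrow> real^'n"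
    and L f_low \<kappa>B \<tau> varsigma vartheta \<theta> \<mu> :: real
    and x w s :: "nat \<Rightarrow> real^'n" and B :: "nat \<Rightarrow> real^'n^'n"
    and n \<Gamma>0 \<kappa>BBL \<kappa>1 \<kappa>2 \<kappa>3 W_arg :: real
  assumes "\<And>y. GDERIV f y :> g y"
    and "continuous_on UNIV g"
    and "L-lipschitz_on UNIV g"
    and "\<And>y. f_low \<le> f y"
    and "0 < varsigma" "varsigma \<le> 1"
    and "0 < vartheta" "vartheta \<le> 1"
    and "0 < \<theta>"
    and "0 < \<mu>" "\<mu> < 1"
    and "1 \<le> \<kappa>B"
    and "0 < \<tau>" "\<tau> \<le> 1"
    and "astr1_run g \<kappa>B \<tau> x w B s"
    and "\<And>k i. let v = \<theta> * (varsigma + (\<Sum>l=0..k. (g (x l) $ i)\<^sup>2)) powr \<mu>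
               in w k $ i \<in> {sqrt vartheta * v .. v}"
    and "n = real CARD('n)"
    and "\<Gamma>0 = f (x 0) - f_low"
    and "\<kappa>BBL = \<kappa>B * (\<kappa>B + L)"
    and "\<kappa>1 = Max {varsigma,
           (2 powr (2 * \<mu>) * vartheta * (1 - 2 * \<mu>) * \<theta>\<^sup>2 * \<Gamma>0 / (n * (\<kappa>B + L))) powr (1 / (1 - 2 * \<mu>)),
           (4 * n * \<kappa>BBL / ((1 - 2 * \<mu>) * \<tau> * \<theta> * varsigma powr \<mu> * vartheta powr (3/2))) powr (1 / \<mu>)}"
    and "W_arg = - (\<tau> * varsigma * \<theta> * vartheta powr (3/2) / (8 * n * \<kappa>B * (\<kappa>B + L)))"
    and "\<kappa>2 = Max {varsigma,
           1/2 * exp (2 * \<Gamma>0 * vartheta * \<theta>\<^sup>2 / (n * (\<kappa>B + L))),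
           1 / (2 * varsigma) * (8 * n * \<kappa>B * (\<kappa>B + L) / (\<tau> * vartheta powr (3/2) * \<theta>))\<^sup>2
             * \<bar>lambert_Wm1 W_arg\<bar>\<^sup>2}"
    and "\<kappa>3 = Max {varsigma,
           (2 powr (1 + \<mu>) * \<kappa>B / (\<tau> * varsigma powr \<mu> * sqrt vartheta)
             * (\<Gamma>0 * \<theta> + n * (\<kappa>B + L) * varsigma powr (1 - 2 * \<mu>) / (2 * vartheta * \<theta> * (2 * \<mu> - 1))))
           powr (1 / (1 - \<mu>))}"
  shows "\<forall>k.
     (0 < \<mu> \<and> \<mu> < 1/2 \<longrightarrow>
        1 / (real k + 1) * (\<Sum>j=0..k. (norm (g (x j)))\<^sup>2) \<le> \<kappa>1 / (real k + 1)) \<and>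
     (\<mu> = 1/2 \<and> W_arg \<in> {- (1 / exp 1)..<0} \<longrightarrow>
        1 / (real k + 1) * (\<Sum>j=0..k. (norm (g (x j)))\<^sup>2) \<le> \<kappa>2 / (real k + 1)) \<and>
     (1/2 < \<mu> \<and> \<mu> < 1 \<longrightarrow>
        1 / (real k + 1) * (\<Sum>j=0..k. (norm (g (x j)))\<^sup>2) \<le> \<kappa>3 / (real k + 1))"
proof (intro allI conjI impI; elim conjE)
  fix k
  let ?S = "\<Sum>j=0..k. (norm (g (x j)))\<^sup>2"
  note f = assms(1) and g = assms(3) and low = assms(4) and \<sigma> = assms(5,6) and \<omega> = assms(7,8)
    and \<theta> = assms(9) and \<mu> = assms(10,11) and \<kappa> = assms(12) and \<tau> = assms(13,14)
    and run = assms(15) and w = assms(16)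
    and n_def = assms(17) and \<Gamma>_def = assms(18) and \<kappa>BBL_def = assms(19)
    and \<kappa>1_def = assms(20) and W_def = assms(21) and \<kappa>2_def = assms(22) and \<kappa>3_def = assms(23)
  \<comment> \<open>\<open>P\<close> and \<open>G\<close> are the two constants of the summed
    estimate; the bounds of each regime are stated in them and translated back at the end.\<close>
  define P where "P = \<tau> * vartheta powr (3/2) * varsigma powr \<mu> * \<theta> / (n * \<kappa>B * (\<kappa>B + L))"
  define G where "G = vartheta * \<theta>\<^sup>2 * \<Gamma>0 / (n * (\<kappa>B + L))"
  have L: "0 \<le> L" using g by (rule lipschitz_on_nonneg)
  have n: "0 < n" by (simp add: n_def)
  have P: "0 < P" using \<tau> \<omega> \<sigma> \<theta> n \<kappa> L by (simp add: P_def)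
  have G: "0 \<le> G" using low[of "x 0"] \<omega> \<theta> n \<kappa> L by (simp add: G_def \<Gamma>_def)
  have S: "0 \<le> ?S" by (simp add: sum_nonneg)
  have bound: "P * (?S / (varsigma + ?S) powr \<mu>) \<le> G + (\<Phi> (varsigma + ?S) - \<Phi> varsigma)"
    if \<Phi>: "\<And>t. 0 < t \<Longrightarrow> (\<Phi> has_real_derivative 1 / t powr (2 * \<mu>)) (at t)" for \<Phi>
  proof -
    have step: "(z - y) * (1 / z powr (2 * \<mu>)) \<le> \<Phi> z - \<Phi> y" if "0 < y" "y \<le> z" for y z
      using \<Phi> one_over_powr_antimono[of "2 * \<mu>"] \<mu> that
      by (intro mult_le_diff_if_deriv_antimono[where \<phi> = "\<lambda>t. 1 / t powr (2 * \<mu>)"]) auto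
    moreover have "\<Phi> y \<le> \<Phi> z" if "0 < y" "y \<le> z" for y z
    proof -
      have "0 \<le> (z - y) * (1 / z powr (2 * \<mu>))" using that by simp
      then show ?thesis using step[OF that] by linarith
    qed
    ultimately show ?thesis
      using astr1_sum_bound[OF f g low \<sigma> \<omega> \<theta> less_imp_le[OF \<mu>(1)] \<kappa> \<tau> run w, of \<Phi> k]
      by (simp add: P_def G_def \<Gamma>_def n_def)
  qed
  have avg: "1 / (real k + 1) * ?S \<le> c / (real k + 1)" if "?S \<le> c" for c
    using that by (simp add: divide_right_mono)
  {
    assume \<mu>2: "\<mu> < 1/2"
    have "?S \<le> max varsigma (max ((2 powr (2 * \<mu>) * (1 - 2 * \<mu>) * G) powr (1 / (1 - 2 * \<mu>)))
        ((4 / ((1 - 2 * \<mu>) * P)) powr (1 / \<mu>)))"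
      using \<mu> \<mu>2 P \<sigma> S bound[OF has_real_derivative_powr_antiderivative]
      by (intro bound_subcritical) auto
    also have "2 powr (2 * \<mu>) * (1 - 2 * \<mu>) * G
        = 2 powr (2 * \<mu>) * vartheta * (1 - 2 * \<mu>) * \<theta>\<^sup>2 * \<Gamma>0 / (n * (\<kappa>B + L))"
      by (simp add: G_def)
    also have "4 / ((1 - 2 * \<mu>) * P)
        = 4 * n * \<kappa>BBL / ((1 - 2 * \<mu>) * \<tau> * \<theta> * varsigma powr \<mu> * vartheta powr (3/2))"
      by (simp add: P_def \<kappa>BBL_def mult_ac)
    finally show "1 / (real k + 1) * ?S \<le> \<kappa>1 / (real k + 1)"
      by (intro avg) (simp add: \<kappa>1_def)
  next
    assume half: "\<mu> = 1/2" and W: "W_arg \<in> {- (1 / exp 1)..<0}"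
    \<comment> \<open>At \<open>\<mu> = 1/2\<close> the extra \<open>sqrt varsigma\<close> combines
      with \<open>varsigma powr \<mu>\<close> into \<open>varsigma\<close>, so \<open>q\<close> is
      exactly \<open>- W_arg\<close>.\<close>
    define q where "q = P * sqrt varsigma / 8"
    have q: "q = \<tau> * varsigma * \<theta> * vartheta powr (3/2) / (8 * n * \<kappa>B * (\<kappa>B + L))"
      using \<sigma> by (simp add: q_def P_def half powr_half_sqrt mult_ac)
    have "?S \<le> max varsigma (max (1/2 * exp (2 * G))
        (1 / (2 * varsigma) * (varsigma / q)\<^sup>2 * \<bar>lambert_Wm1 (- q)\<bar>\<^sup>2))"
      unfolding q_def
    proof (rule bound_critical)
      \<comment> \<open>This is the condition that \<open>W_arg\<close> lies in the domain of the
        branch.\<close>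
      show "P * sqrt varsigma / 8 \<le> 1 / exp 1"
        using W unfolding q_def[symmetric] q W_def by simp
      show "P * (?S / sqrt (varsigma + ?S)) \<le> G + (ln (varsigma + ?S) - ln varsigma)"
        using bound[of ln] \<sigma> S by (simp add: half powr_half_sqrt DERIV_ln_divide)
    qed (use P \<sigma> S in auto)
    also have "2 * G = 2 * \<Gamma>0 * vartheta * \<theta>\<^sup>2 / (n * (\<kappa>B + L))"
      by (simp add: G_def)
    also have "varsigma / q = 8 * n * \<kappa>B * (\<kappa>B + L) / (\<tau> * vartheta powr (3/2) * \<theta>)"
      using \<sigma> by (simp add: q mult_ac)
    also have "- q = W_arg"
      by (simp add: q W_def)
    finally show "1 / (real k + 1) * ?S \<le> \<kappa>2 / (real k + 1)"
      by (intro avg) (simp add: \<kappa>2_def)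
  next
    assume \<mu>2: "1/2 < \<mu>"
    have "?S \<le> max varsigma ((2 powr (1 + \<mu>) / P
        * (G + varsigma powr (1 - 2 * \<mu>) / (2 * (2 * \<mu> - 1)))) powr (1 / (1 - \<mu>)))"
      using \<mu> \<mu>2 P G \<sigma> S bound[OF has_real_derivative_powr_antiderivative]
      by (intro bound_supercritical) auto
    also have "2 powr (1 + \<mu>) / P * (G + varsigma powr (1 - 2 * \<mu>) / (2 * (2 * \<mu> - 1)))
        = 2 powr (1 + \<mu>) * \<kappa>B / (\<tau> * varsigma powr \<mu> * sqrt vartheta)
             * (\<Gamma>0 * \<theta> + n * (\<kappa>B + L) * varsigma powr (1 - 2 * \<mu>) / (2 * vartheta * \<theta> * (2 * \<mu> - 1)))"
    \<comment> \<open>The factor \<open>n * (\<kappa>B + L) / (vartheta * \<theta>)\<close> is split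
      off from \<open>1 / P\<close> and moved into the bracket, where it turns \<open>G\<close> into
      \<open>\<Gamma>0 * \<theta>\<close>.\<close>
    proof -
      have v: "vartheta powr (3/2) = vartheta * sqrt vartheta"
        using \<omega> powr_add[of vartheta 1 "1/2"] by (simp add: powr_half_sqrt)
      have "2 powr (1 + \<mu>) / P = 2 powr (1 + \<mu>) * \<kappa>B / (\<tau> * varsigma powr \<mu> * sqrt vartheta)
          * (n * (\<kappa>B + L) / (vartheta * \<theta>))"
        by (simp add: P_def v mult_ac)
      moreover have "n * (\<kappa>B + L) / (vartheta * \<theta>) * (G + varsigma powr (1 - 2 * \<mu>) / (2 * (2 * \<mu> - 1)))
          = \<Gamma>0 * \<theta> + n * (\<kappa>B + L) * varsigma powr (1 - 2 * \<mu>) / (2 * vartheta * \<theta> * (2 * \<mu> - 1))"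
      proof -
        have "n * (\<kappa>B + L) / (vartheta * \<theta>) * G = \<Gamma>0 * \<theta>"
          using n \<kappa> L \<omega> \<theta> by (simp add: G_def power2_eq_square)
        then show ?thesis by (simp add: distrib_left mult_ac)
      qed
      ultimately show ?thesis by (simp only: mult.assoc)
    qed
    finally show "1 / (real k + 1) * ?S \<le> \<kappa>3 / (real k + 1)"
      by (intro avg) (simp add: \<kappa>3_def)
  }
qed

end
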